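(* If an absorption identity holds in some nontrivial meld $\mathbb{A}$, then it is a consequence of idempotence $xx \approx x$ together with the absorption identity $x((yx)z) \approx x$.
   Context: A meld is an idempotent groupoid $(A,\cdot)$ (a set with one binary operation written by juxtaposition, with $xx \approx x$) satisfying $(xy)(zx) \approx xy$. It is nontrivial if its operation is not a projection. An absorption identity is an identity $t(x_1,\dots,x_n) \approx x_i$, where $t$ is a term in the language with the single binary operation symbol. *)

theory Defs
  imports Main
begin

text \<open>
  Groupoids are given by an explicit carrier and a binary operation. Emptiness of the carrier
  is not excluded: the empty groupoid satisfies every identity and its operation is a projection.
\<close>

definition groupoid :: "'a set \<Rightarrow> ('a \<Rightarrow> 'a \<Rightarrow> 'a) \<Rightarrow> bool" where
  "groupoid A f \<longleftrightarrow> (\<forall>x\<in>A. \<forall>y\<in>A. f x y \<in> A)"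

definition meld :: "'a set \<Rightarrow> ('a \<Rightarrow> 'a \<Rightarrow> 'a) \<Rightarrow> bool" where
  "meld A f \<longleftrightarrow> groupoid A f \<and> (\<forall>x\<in>A. f x x = x) \<and>
     (\<forall>x\<in>A. \<forall>y\<in>A. \<forall>z\<in>A. f (f x y) (f z x) = f x y)"

definition is_projection :: "'a set \<Rightarrow> ('a \<Rightarrow> 'a \<Rightarrow> 'a) \<Rightarrow> bool" where
  "is_projection A f \<longleftrightarrow> (\<forall>x\<in>A. \<forall>y\<in>A. f x y = x) \<or> (\<forall>x\<in>A. \<forall>y\<in>A. f x y = y)"

definition nontrivial_meld :: "'a set \<Rightarrow> ('a \<Rightarrow> 'a \<Rightarrow> 'a) \<Rightarrow> bool" where
  "nontrivial_meld A f \<longleftrightarrow> meld A f \<and> \<not> is_projection A f"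

datatype trm = Var nat | Mul trm trm (infixl "\<cdot>" 70)

primrec eval :: "('a \<Rightarrow> 'a \<Rightarrow> 'a) \<Rightarrow> (nat \<Rightarrow> 'a) \<Rightarrow> trm \<Rightarrow> 'a" where
  "eval f v (Var i) = v i"
| "eval f v (s \<cdot> t) = f (eval f v s) (eval f v t)"

datatype identity = Identity trm trm (infix "\<approx>" 50)

primrec satisfies :: "'a set \<Rightarrow> ('a \<Rightarrow> 'a \<Rightarrow> 'a) \<Rightarrow> identity \<Rightarrow> bool" where
  "satisfies A f (s \<approx> t) \<longleftrightarrow> (\<forall>v. (\<forall>i. v i \<in> A) \<longrightarrow> eval f v s = eval f v t)"

text \<open>
  HOL cannot quantify over types inside a formula, so the type hosting the carriers of the models
  is a parameter; a theorem stated for a type variable here ranges over all groupoids.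
\<close>

definition consequence :: "'b itself \<Rightarrow> identity set \<Rightarrow> identity \<Rightarrow> bool" where
  "consequence ty E e \<longleftrightarrow>
     (\<forall>(B :: 'b set) g. groupoid B g \<longrightarrow> (\<forall>d\<in>E. satisfies B g d) \<longrightarrow> satisfies B g e)"

end

theory Submission
  imports Defs
begin

text \<open>
  Say that \<open>p\<close> absorbs \<open>q\<close> if \<open>pq = p\<close>. Pick \<open>a\<close>, \<open>b\<close> in the nontrivial meld with
  \<open>ab \<noteq> a\<close>. Then \<open>{a, b, ab, ba}\<close> is a subalgebra whose operation is the left projection,
  except for the products of \<open>a\<close> and \<open>b\<close>. Evaluate terms there, sending \<open>x\<close> to \<open>a\<close> and every
  other variable to \<open>b\<close>. By a simultaneous induction on \<open>s\<close>, the two identities imply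
  \<open>s \<approx> x\<close> if \<open>s\<close> takes the value \<open>a\<close>, and they imply that \<open>x\<close> absorbs \<open>s\<close> if \<open>s\<close> does
  not take the value \<open>b\<close>. An identity \<open>t \<approx> x\<close> of the meld forces the value of \<open>t\<close> to be \<open>a\<close>.
\<close>

locale absorbing_groupoid =
  fixes B :: "'b set" and g :: "'b \<Rightarrow> 'b \<Rightarrow> 'b"
  assumes closed: "x \<in> B \<Longrightarrow> y \<in> B \<Longrightarrow> g x y \<in> B"
    and idem: "x \<in> B \<Longrightarrow> g x x = x"
    and absorb: "x \<in> B \<Longrightarrow> y \<in> B \<Longrightarrow> z \<in> B \<Longrightarrow> g x (g (g y x) z) = x"
begin

lemma eval_closed: "(\<And>j. w j \<in> B) \<Longrightarrow> eval g w s \<in> B"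
  by (induction s) (auto intro: closed)

text \<open>Take \<open>z = yx\<close> in the absorption law; idempotence collapses
  \<open>(yx)(yx)\<close>.\<close>

lemma absorb_left_mult:
  assumes "x \<in> B" "y \<in> B"
  shows "g x (g y x) = x"
  using absorb[of x y "g y x"] idem[of "g y x"] closed assms by simp

text \<open>Absorption is symmetric: \<open>xq = x\<close> gives \<open>qx = q(xq) = q\<close>, so
  \<open>qz = (qx)z\<close>.\<close>

lemma absorb_right_mult:
  assumes "x \<in> B" "q \<in> B" "z \<in> B" and "g x q = x"
  shows "g x (g q z) = x"
proof -
  have "g q x = q"
    using absorb_left_mult[of q x] assms by simp
  then show ?thesis
    using absorb[of x q z] assms by simp
qed

end

locale nontrivial_pair =
  fixes A :: "'a set" and f :: "'a \<Rightarrow> 'a \<Rightarrow> 'a" and a b :: 'a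
  assumes meld: "meld A f" and a: "a \<in> A" and b: "b \<in> A" and neq: "f a b \<noteq> a"
begin

lemma closed: "x \<in> A \<Longrightarrow> y \<in> A \<Longrightarrow> f x y \<in> A"
  using meld by (simp add: meld_def groupoid_def)

lemma idem: "x \<in> A \<Longrightarrow> f x x = x"
  using meld by (simp add: meld_def)

lemma meld_eq: "x \<in> A \<Longrightarrow> y \<in> A \<Longrightarrow> z \<in> A \<Longrightarrow> f (f x y) (f z x) = f x y"
  using meld by (simp add: meld_def)

lemma mult_left_factor: "x \<in> A \<Longrightarrow> y \<in> A \<Longrightarrow> f (f x y) x = f x y"
  using meld_eq[of x y x] idem by simp

lemma absorb_left_mult: "x \<in> A \<Longrightarrow> y \<in> A \<Longrightarrow> f x (f y x) = x"
  using meld_eq[of x x y] idem by simp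

lemma absorb_right_mult: "x \<in> A \<Longrightarrow> y \<in> A \<Longrightarrow> f x (f x y) = x"
  using absorb_left_mult[of x "f x y"] mult_left_factor closed by simp

lemma mult_right_factor: "x \<in> A \<Longrightarrow> y \<in> A \<Longrightarrow> f (f x y) y = f x y"
  using absorb_left_mult[of "f x y" y] absorb_left_mult[of y x] closed by simp

text \<open>Each of the excluded equalities would force \<open>ab = a\<close>.\<close>

lemma products_distinct: "a \<noteq> b" "f a b \<noteq> b" "f b a \<noteq> a" "f b a \<noteq> b"
  using neq idem a b absorb_left_mult[of a b] mult_left_factor[of a b] mult_left_factor[of b a]
  by metis+

text \<open>Together these rules evaluate all products among \<open>a\<close>, \<open>b\<close>,
  \<open>ab\<close>, \<open>ba\<close>.\<close>

lemmas table = idem mult_left_factor mult_right_factor absorb_left_mult absorb_right_mult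
  meld_eq closed

lemma eval_range:
  assumes "\<And>j. w j \<in> {a, b}"
  shows "eval f w s \<in> {a, b, f a b, f b a}"
proof (induction s)
  case (Var j)
  then show ?case using assms[of j] by auto
next
  case (Mul s1 s2)
  then show ?case using a b by (auto simp: table)
qed

text \<open>In the table, \<open>a\<close> occurs only in its own row, and there not in column
  \<open>b\<close>.\<close>

lemma mult_eq_aD:
  assumes "p \<in> {a, b, f a b, f b a}" "q \<in> {a, b, f a b, f b a}" "f p q = a"
  shows "p = a" "q \<noteq> b"
proof -
  have "\<forall>p \<in> {a, b, f a b, f b a}. \<forall>q \<in> {a, b, f a b, f b a}. f p q = a \<longrightarrow> p = a \<and> q \<noteq> b"
    by (simp add: table a b neq products_distinct products_distinct[symmetric])
  then show "p = a" "q \<noteq> b"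
    using assms by blast+
qed

lemma mult_neq_bD:
  assumes "q \<in> {a, b, f a b, f b a}" "f b q \<noteq> b"
  shows "q = a"
  using assms a b by (auto simp: table)

lemma eval_transfer:
  fixes i :: nat
  assumes "absorbing_groupoid B g" and w: "\<And>j. w j \<in> B"
  defines "v \<equiv> (\<lambda>j. if j = i then a else b)"
  shows "(eval f v s = a \<longrightarrow> eval g w s = w i) \<and>
    (eval f v s \<noteq> b \<longrightarrow> g (w i) (eval g w s) = w i)"
proof -
  interpret absorbing_groupoid B g by fact
  have range: "eval f v s \<in> {a, b, f a b, f b a}" for s
    by (rule eval_range) (simp add: v_def)
  have mem: "eval g w s \<in> B" for s
    by (rule eval_closed) (rule w)
  show ?thesis
  proof (induction s)
    case (Var j)
    show ?case using w products_distinct by (auto simp: v_def idem)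
  next
    case (Mul s1 s2)
    have "eval g w (s1 \<cdot> s2) = w i" if "eval f v (s1 \<cdot> s2) = a"
      \<comment> \<open>By induction \<open>s1\<close> becomes \<open>w i\<close>, which absorbs
        \<open>s2\<close>.\<close>
      using mult_eq_aD[OF range range, of s1 s2] that Mul by simp
    moreover have "g (w i) (eval g w (s1 \<cdot> s2)) = w i" if "eval f v (s1 \<cdot> s2) \<noteq> b"
    proof (cases "eval f v s1 = b")
      case True
      \<comment> \<open>Row \<open>b\<close> leaves the value \<open>b\<close> only in column
        \<open>a\<close>. Then \<open>s2\<close> becomes \<open>w i\<close> in \<open>B\<close>, and
        \<open>x(yx) = x\<close> applies.\<close>
      then have "eval f v s2 = a"
        using mult_neq_bD[OF range] that by simp
      then show ?thesis
        using Mul absorb_left_mult[OF w mem] by simp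
    next
      case False
      \<comment> \<open>By induction \<open>w i\<close> absorbs \<open>s1\<close>, hence also its
        right multiple.\<close>
      then show ?thesis
        using Mul absorb_right_mult[OF w mem mem] by simp
    qed
    ultimately show ?case by blast
  qed
qed

end

text \<open>The pair witnesses that the operation is not the left projection.\<close>

lemma nontrivial_meld_pair:
  assumes "nontrivial_meld A f"
  obtains a b where "nontrivial_pair A f a b"
  using assms by (auto simp: nontrivial_meld_def is_projection_def nontrivial_pair_def)

lemma absorbing_groupoidI:
  assumes "groupoid B g"
    and idem: "satisfies B g (Var 0 \<cdot> Var 0 \<approx> Var 0)"
    and absorb: "satisfies B g (Var 0 \<cdot> ((Var 1 \<cdot> Var 0) \<cdot> Var 2) \<approx> Var 0)"
  shows "absorbing_groupoid B g"
proof
  show "g x y \<in> B" if "x \<in> B" "y \<in> B" for x y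
    using assms(1) that by (simp add: groupoid_def)
  show "g x x = x" if "x \<in> B" for x
    using idem[unfolded satisfies.simps, rule_format, of "\<lambda>_. x"] that by simp
  show "g x (g (g y x) z) = x" if "x \<in> B" "y \<in> B" "z \<in> B" for x y z
    using absorb[unfolded satisfies.simps, rule_format,
        of "\<lambda>j. if j = 0 then x else if j = 1 then y else z"] that
    by simp
qed

theorem corollary8:
  fixes A :: "'a set" and f :: "'a \<Rightarrow> 'a \<Rightarrow> 'a" and t :: trm and i :: nat
  assumes "nontrivial_meld A f"
    and "satisfies A f (t \<approx> Var i)"
  shows "consequence TYPE('b)
     {Var 0 \<cdot> Var 0 \<approx> Var 0, Var 0 \<cdot> ((Var 1 \<cdot> Var 0) \<cdot> Var 2) \<approx> Var 0}
     (t \<approx> Var i)"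
proof -
  obtain a b where "nontrivial_pair A f a b"
    using assms(1) by (rule nontrivial_meld_pair)
  then interpret nontrivial_pair A f a b .
  have "eval f (\<lambda>j. if j = i then a else b) t = a"
    using assms(2) a b by simp
  then have "satisfies B g (t \<approx> Var i)" if "absorbing_groupoid B g" for B :: "'b set" and g
    using eval_transfer[OF that, of _ i t] by simp
  then show ?thesis
    unfolding consequence_def by (blast intro: absorbing_groupoidI)
qed

end
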